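(* The octonionic slice monogenic Hardy space $\mathbf{H}^2(B_8(0,1),\mathbb{O})$ of the unit ball has a uniquely defined reproducing kernel, namely the octonionic slice monogenic Szeg\"o kernel $$\mathcal{S}(y,x)=(1-2{\rm Re}(x)y+|x|^2y^2)^{-1}(1-yx)=(1-\bar y\bar x)(1-2{\rm Re}(y)\bar x+|y|^2\bar x^2)^{-1},$$ which has the reproducing property $$[f,\mathcal{S}(\cdot,x)]=f(x)$$ for any $f\in\mathbf{H}^2(B_8(0,1),\mathbb{O})$ (and any $x\in B_8(0,1)$).
   Context: $\mathbb{O}\cong\mathbb{R}^8$ denotes the (non-associative) octonions with conjugation $x\mapsto\bar{x}$, real part ${\rm Re}(x)$ and norm $|x|=\sqrt{x\bar{x}}$; $B_8(0,1)=\{x\in\mathbb{O}:|x|<1\}$. With $\mathbb{S}$ the sphere of purely imaginary unit octonions and $\mathbb{C}_I=\mathbb{R}+\mathbb{R}I$ for $I\in\mathbb{S}$, a real differentiable $f:B_8(0,1)\to\mathbb{O}$ is slice monogenic if for every $I\in\mathbb{S}$ its restriction to $B_8(0,1)\cap\mathbb{C}_I$ satisfies $\frac12(\frac{\partial}{\partial u}+I\frac{\partial}{\partial v})f(u+Iv)=0$; equivalently $f(x)=\sum_{n\ge0}x^na_n$ is a convergent power series with coefficients $a_n\in\mathbb{O}$ on the right. $\mathbf{H}^2(B_8(0,1),\mathbb{O})$ is the set of slice monogenic $f(x)=\sum_{n\ge0}x^na_n$ on $B_8(0,1)$ with $\sum_{n\ge0}|a_n|^2<\infty$, with inner product $[f,g]=\sum_{n\ge0}\overline{b_n}a_n$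 for $g(x)=\sum_{n\ge0}x^nb_n$. For $x,y\in B_8(0,1)$ one has $\mathcal{S}(y,x)=\sum_{n\ge0}y^n\bar x^n$. *)

theory Defs
  imports "HOL-Analysis.Analysis"
begin

section \<open>The octonions\<close>

datatype octonion =
  Octonion (Ree: real) (Im1: real) (Im2: real) (Im3: real)
    (Im4: real) (Im5: real) (Im6: real) (Im7: real)

lemma octonion_eq_iff:
  "x = y \<longleftrightarrow> Ree x = Ree y \<and> Im1 x = Im1 y \<and> Im2 x = Im2 y \<and> Im3 x = Im3 y \<and>
     Im4 x = Im4 y \<and> Im5 x = Im5 y \<and> Im6 x = Im6 y \<and> Im7 x = Im7 y"
  by (cases x; cases y) simp

instantiation octonion :: real_vector
begin

definition zero_octonion :: octonion where
  "0 = Octonion 0 0 0 0 0 0 0 0"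

definition plus_octonion :: "octonion \<Rightarrow> octonion \<Rightarrow> octonion" where
  "x + y = Octonion (Ree x + Ree y) (Im1 x + Im1 y) (Im2 x + Im2 y) (Im3 x + Im3 y)
     (Im4 x + Im4 y) (Im5 x + Im5 y) (Im6 x + Im6 y) (Im7 x + Im7 y)"

definition uminus_octonion :: "octonion \<Rightarrow> octonion" where
  "- x = Octonion (- Ree x) (- Im1 x) (- Im2 x) (- Im3 x) (- Im4 x) (- Im5 x) (- Im6 x) (- Im7 x)"

definition minus_octonion :: "octonion \<Rightarrow> octonion \<Rightarrow> octonion" where
  "x - y = Octonion (Ree x - Ree y) (Im1 x - Im1 y) (Im2 x - Im2 y) (Im3 x - Im3 y)
     (Im4 x - Im4 y) (Im5 x - Im5 y) (Im6 x - Im6 y) (Im7 x - Im7 y)"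

definition scaleR_octonion :: "real \<Rightarrow> octonion \<Rightarrow> octonion" where
  "r *\<^sub>R x = Octonion (r * Ree x) (r * Im1 x) (r * Im2 x) (r * Im3 x)
     (r * Im4 x) (r * Im5 x) (r * Im6 x) (r * Im7 x)"

instance
  by standard
    (simp_all add: octonion_eq_iff zero_octonion_def plus_octonion_def uminus_octonion_def
      minus_octonion_def scaleR_octonion_def algebra_simps)

end

lemma octonion_linear_simps [simp]:
  "Ree 0 = 0" "Im1 0 = 0" "Im2 0 = 0" "Im3 0 = 0"
  "Im4 0 = 0" "Im5 0 = 0" "Im6 0 = 0" "Im7 0 = 0"
  "Ree (x + y) = Ree x + Ree y" "Im1 (x + y) = Im1 x + Im1 y"
  "Im2 (x + y) = Im2 x + Im2 y" "Im3 (x + y) = Im3 x + Im3 y"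
  "Im4 (x + y) = Im4 x + Im4 y" "Im5 (x + y) = Im5 x + Im5 y"
  "Im6 (x + y) = Im6 x + Im6 y" "Im7 (x + y) = Im7 x + Im7 y"
  "Ree (- x) = - Ree x" "Im1 (- x) = - Im1 x" "Im2 (- x) = - Im2 x" "Im3 (- x) = - Im3 x"
  "Im4 (- x) = - Im4 x" "Im5 (- x) = - Im5 x" "Im6 (- x) = - Im6 x" "Im7 (- x) = - Im7 x"
  "Ree (x - y) = Ree x - Ree y" "Im1 (x - y) = Im1 x - Im1 y"
  "Im2 (x - y) = Im2 x - Im2 y" "Im3 (x - y) = Im3 x - Im3 y"
  "Im4 (x - y) = Im4 x - Im4 y" "Im5 (x - y) = Im5 x - Im5 y"
  "Im6 (x - y) = Im6 x - Im6 y" "Im7 (x - y) = Im7 x - Im7 y"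
  "Ree (r *\<^sub>R x) = r * Ree x" "Im1 (r *\<^sub>R x) = r * Im1 x"
  "Im2 (r *\<^sub>R x) = r * Im2 x" "Im3 (r *\<^sub>R x) = r * Im3 x"
  "Im4 (r *\<^sub>R x) = r * Im4 x" "Im5 (r *\<^sub>R x) = r * Im5 x"
  "Im6 (r *\<^sub>R x) = r * Im6 x" "Im7 (r *\<^sub>R x) = r * Im7 x"
  by (simp_all add: zero_octonion_def plus_octonion_def uminus_octonion_def
      minus_octonion_def scaleR_octonion_def)

instantiation octonion :: real_inner
begin

definition inner_octonion :: "octonion \<Rightarrow> octonion \<Rightarrow> real" where
  "x \<bullet> y = Ree x * Ree y + Im1 x * Im1 y + Im2 x * Im2 y + Im3 x * Im3 y +
     Im4 x * Im4 y + Im5 x * Im5 y + Im6 x * Im6 y + Im7 x * Im7 y"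

definition norm_octonion :: "octonion \<Rightarrow> real" where
  "norm x = sqrt ((Ree x)\<^sup>2 + (Im1 x)\<^sup>2 + (Im2 x)\<^sup>2 + (Im3 x)\<^sup>2 +
     (Im4 x)\<^sup>2 + (Im5 x)\<^sup>2 + (Im6 x)\<^sup>2 + (Im7 x)\<^sup>2)"

definition sgn_octonion :: "octonion \<Rightarrow> octonion" where
  "sgn x = x /\<^sub>R norm (x :: octonion)"

definition dist_octonion :: "octonion \<Rightarrow> octonion \<Rightarrow> real" where
  "dist x y = norm (x - y :: octonion)"

definition uniformity_octonion :: "(octonion \<times> octonion) filter" where
  "uniformity = (INF e\<in>{0<..}. principal {(x :: octonion, y). dist x y < e})"

definition open_octonion :: "octonion set \<Rightarrow> bool" where
  "open (U :: octonion set) \<longleftrightarrow> (\<forall>x\<in>U. eventually (\<lambda>(x', y). x' = x \<longrightarrow> y \<in> U) uniformity)"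

instance
proof
  fix x y z :: octonion and r :: real and U :: "octonion set"
  show "dist x y = norm (x - y :: octonion)"
    by (rule dist_octonion_def)
  show "sgn x = x /\<^sub>R norm (x :: octonion)"
    by (rule sgn_octonion_def)
  show "uniformity = (INF e\<in>{0<..}. principal {(x::octonion, y). dist x y < e})"
    by (rule uniformity_octonion_def)
  show "open U \<longleftrightarrow> (\<forall>x\<in>U. \<forall>\<^sub>F (x', y) in uniformity. x' = x \<longrightarrow> y \<in> U)"
    by (rule open_octonion_def)
  show "x \<bullet> y = y \<bullet> x"
    by (simp add: inner_octonion_def mult.commute)
  show "(x + y) \<bullet> z = x \<bullet> z + y \<bullet> z"
    by (simp add: inner_octonion_def algebra_simps)
  show "(r *\<^sub>R x) \<bullet> y = r * (x \<bullet> y)"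
    by (simp add: inner_octonion_def algebra_simps)
  show "0 \<le> x \<bullet> x"
    by (simp add: inner_octonion_def)
  show "x \<bullet> x = 0 \<longleftrightarrow> x = 0"
    by (auto simp: inner_octonion_def octonion_eq_iff add_nonneg_eq_0_iff)
  show "norm x = sqrt (x \<bullet> x)"
    by (simp add: norm_octonion_def inner_octonion_def power2_eq_square)
qed

end

instantiation octonion :: euclidean_space
begin

definition Basis_octonion :: "octonion set" where
  "Basis = {Octonion 1 0 0 0 0 0 0 0, Octonion 0 1 0 0 0 0 0 0, Octonion 0 0 1 0 0 0 0 0,
     Octonion 0 0 0 1 0 0 0 0, Octonion 0 0 0 0 1 0 0 0, Octonion 0 0 0 0 0 1 0 0,
     Octonion 0 0 0 0 0 0 1 0, Octonion 0 0 0 0 0 0 0 1}"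

instance
proof
  show "(Basis :: octonion set) \<noteq> {}" "finite (Basis :: octonion set)"
    by (simp_all add: Basis_octonion_def)
  fix u v :: octonion
  assume "u \<in> Basis" "v \<in> Basis"
  then show "u \<bullet> v = (if u = v then 1 else 0)"
    unfolding Basis_octonion_def by (elim insertE emptyE; simp add: inner_octonion_def)
next
  fix x :: octonion
  show "(\<forall>u\<in>Basis. x \<bullet> u = 0) \<longleftrightarrow> x = 0"
    by (simp add: Basis_octonion_def inner_octonion_def octonion_eq_iff [of x 0])
qed

end

lemma DIM_octonion: "DIM(octonion) = 8"
  by (simp add: Basis_octonion_def)

text \<open>
  The multiplication is the Cayley--Dickson product
  \<open>(a + b e\<^sub>3)(c + d e\<^sub>3) = (a c - d\<^sup>* b) + (d a + b c\<^sup>*) e\<^sub>3\<close> over the quaternions spanned by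
  \<open>1, e\<^sub>1, e\<^sub>2, e\<^sub>4\<close>; the imaginary units are numbered so that \<open>e\<^sub>4 = e\<^sub>1 e\<^sub>2\<close>, \<open>e\<^sub>5 = e\<^sub>1 e\<^sub>3\<close>,
  \<open>e\<^sub>6 = e\<^sub>2 e\<^sub>3\<close> and \<open>e\<^sub>7 = e\<^sub>4 e\<^sub>3\<close>.  As the product is not associative, powers are only
  available through the class \<open>power\<close>, with \<open>x ^ Suc n = x * x ^ n\<close>.
\<close>

instantiation octonion :: "{one, times, inverse}"
begin

definition one_octonion :: octonion where
  "1 = Octonion 1 0 0 0 0 0 0 0"

definition times_octonion :: "octonion \<Rightarrow> octonion \<Rightarrow> octonion" where
  "x * y = Octonion
     (Ree x * Ree y - Im1 x * Im1 y - Im2 x * Im2 y - Im3 x * Im3 y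
        - Im4 x * Im4 y - Im5 x * Im5 y - Im6 x * Im6 y - Im7 x * Im7 y)
     (Ree x * Im1 y + Im1 x * Ree y + Im2 x * Im4 y + Im3 x * Im5 y
        - Im4 x * Im2 y - Im5 x * Im3 y - Im6 x * Im7 y + Im7 x * Im6 y)
     (Ree x * Im2 y - Im1 x * Im4 y + Im2 x * Ree y + Im3 x * Im6 y
        + Im4 x * Im1 y + Im5 x * Im7 y - Im6 x * Im3 y - Im7 x * Im5 y)
     (Ree x * Im3 y - Im1 x * Im5 y - Im2 x * Im6 y + Im3 x * Ree y
        - Im4 x * Im7 y + Im5 x * Im1 y + Im6 x * Im2 y + Im7 x * Im4 y)
     (Ree x * Im4 y + Im1 x * Im2 y - Im2 x * Im1 y + Im3 x * Im7 y
        + Im4 x * Ree y - Im5 x * Im6 y + Im6 x * Im5 y - Im7 x * Im3 y)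
     (Ree x * Im5 y + Im1 x * Im3 y - Im2 x * Im7 y - Im3 x * Im1 y
        + Im4 x * Im6 y + Im5 x * Ree y - Im6 x * Im4 y + Im7 x * Im2 y)
     (Ree x * Im6 y + Im1 x * Im7 y + Im2 x * Im3 y - Im3 x * Im2 y
        - Im4 x * Im5 y + Im5 x * Im4 y + Im6 x * Ree y - Im7 x * Im1 y)
     (Ree x * Im7 y - Im1 x * Im6 y + Im2 x * Im5 y - Im3 x * Im4 y
        + Im4 x * Im3 y - Im5 x * Im2 y + Im6 x * Im1 y + Im7 x * Ree y)"

definition inverse_octonion :: "octonion \<Rightarrow> octonion" where
  "inverse x = Octonion (Ree x / (norm x)\<^sup>2) (- Im1 x / (norm x)\<^sup>2) (- Im2 x / (norm x)\<^sup>2)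
     (- Im3 x / (norm x)\<^sup>2) (- Im4 x / (norm x)\<^sup>2) (- Im5 x / (norm x)\<^sup>2)
     (- Im6 x / (norm x)\<^sup>2) (- Im7 x / (norm x)\<^sup>2)"

definition divide_octonion :: "octonion \<Rightarrow> octonion \<Rightarrow> octonion" where
  "x div y = x * inverse (y :: octonion)"

instance ..

end

instance octonion :: power ..

definition ocnj :: "octonion \<Rightarrow> octonion" where
  "ocnj x = Octonion (Ree x) (- Im1 x) (- Im2 x) (- Im3 x) (- Im4 x) (- Im5 x) (- Im6 x) (- Im7 x)"

lemma octonion_mult_ocnj: "x * ocnj x = (norm x)\<^sup>2 *\<^sub>R 1" "ocnj x * x = (norm x)\<^sup>2 *\<^sub>R 1"
  by (simp_all add: octonion_eq_iff times_octonion_def ocnj_def one_octonion_def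
      power2_norm_eq_inner inner_octonion_def)

lemma octonion_inverse_conv_ocnj: "inverse x = (1 / (norm x)\<^sup>2) *\<^sub>R ocnj x"
  by (simp add: octonion_eq_iff inverse_octonion_def ocnj_def)

lemma octonion_mult_one [simp]: "1 * x = x" "x * 1 = (x :: octonion)"
  by (simp_all add: octonion_eq_iff times_octonion_def one_octonion_def)

lemma octonion_inverse_mult:
  fixes x :: octonion
  assumes "x \<noteq> 0"
  shows "inverse x * x = 1" "x * inverse x = 1"
proof -
  have "(c *\<^sub>R ocnj x) * x = c *\<^sub>R (ocnj x * x)" "x * (c *\<^sub>R ocnj x) = c *\<^sub>R (x * ocnj x)" for c
    by (simp_all add: octonion_eq_iff times_octonion_def algebra_simps)
  then show "inverse x * x = 1" "x * inverse x = 1"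
    using assms by (simp_all add: octonion_inverse_conv_ocnj octonion_mult_ocnj)
qed

lemma octonion_alternative:
  fixes x y :: octonion
  shows "x * (x * y) = (x * x) * y" "(y * x) * x = y * (x * x)"
  by (simp_all add: octonion_eq_iff times_octonion_def algebra_simps)

lemma octonion_norm_mult: "norm (x * y) = norm x * norm (y :: octonion)"
proof -
  have "(x * y) \<bullet> z = y \<bullet> (ocnj x * z)" for z
    by (simp add: inner_octonion_def times_octonion_def ocnj_def algebra_simps)
  moreover have "ocnj x * (x * y) = (x \<bullet> x) *\<^sub>R y"
    by (simp add: octonion_eq_iff inner_octonion_def times_octonion_def ocnj_def algebra_simps)
  ultimately have "(x * y) \<bullet> (x * y) = (x \<bullet> x) * (y \<bullet> y)"
    by simp
  then show ?thesis
    by (simp add: norm_eq_sqrt_inner real_sqrt_mult)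
qed


section \<open>Slice monogenic functions and the Hardy space of the unit ball\<close>

definition imaginary_units :: "octonion set" where
  "imaginary_units = {I. Ree I = 0 \<and> norm I = 1}"

text \<open>
  For open \<open>U\<close> the two vector derivatives are the partial derivatives
  \<open>\<partial>/\<partial>u\<close> and \<open>\<partial>/\<partial>v\<close> of \<open>f (u + I v)\<close>; they exist because \<open>f\<close> is differentiable.
\<close>

definition slice_monogenic_on :: "octonion set \<Rightarrow> (octonion \<Rightarrow> octonion) \<Rightarrow> bool" where
  "slice_monogenic_on U f \<longleftrightarrow>
     f differentiable_on U \<and>
     (\<forall>I\<in>imaginary_units. \<forall>u v. u *\<^sub>R 1 + v *\<^sub>R I \<in> U \<longrightarrow>
        (1/2) *\<^sub>R (vector_derivative (\<lambda>s. f (s *\<^sub>R 1 + v *\<^sub>R I)) (at u)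
                  + I * vector_derivative (\<lambda>t. f (u *\<^sub>R 1 + t *\<^sub>R I)) (at v)) = 0)"

definition has_expansion :: "(octonion \<Rightarrow> octonion) \<Rightarrow> (nat \<Rightarrow> octonion) \<Rightarrow> bool" where
  "has_expansion f a \<longleftrightarrow> (\<forall>x\<in>ball 0 1. (\<lambda>n. x ^ n * a n) sums f x)"

text \<open>
  Functions are total in HOL; only the values on the open unit ball matter for membership
  in the Hardy space and for the inner product.
\<close>

definition hardy2 :: "(octonion \<Rightarrow> octonion) set" where
  "hardy2 = {f. slice_monogenic_on (ball 0 1) f \<and>
     (\<exists>a. has_expansion f a \<and> summable (\<lambda>n. (norm (a n))\<^sup>2))}"

definition expansion_coeffs :: "(octonion \<Rightarrow> octonion) \<Rightarrow> nat \<Rightarrow> octonion" where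
  "expansion_coeffs f = (THE a. has_expansion f a)"

definition hardy_inner :: "(octonion \<Rightarrow> octonion) \<Rightarrow> (octonion \<Rightarrow> octonion) \<Rightarrow> octonion" where
  "hardy_inner f g = (\<Sum>n. ocnj (expansion_coeffs g n) * expansion_coeffs f n)"

definition reproducing_kernel :: "(octonion \<Rightarrow> octonion \<Rightarrow> octonion) \<Rightarrow> bool" where
  "reproducing_kernel K \<longleftrightarrow>
     (\<forall>x\<in>ball 0 1. (\<lambda>y. K y x) \<in> hardy2 \<and>
        (\<forall>f\<in>hardy2. hardy_inner f (\<lambda>y. K y x) = f x))"

definition szego_kernel :: "octonion \<Rightarrow> octonion \<Rightarrow> octonion" where
  "szego_kernel y x =
     inverse (1 - (2 * Ree x) *\<^sub>R y + (norm x)\<^sup>2 *\<^sub>R y\<^sup>2) * (1 - y * x)"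

end

theory Submission
  imports Defs
begin

text \<open>
  Everything rests on the expansion \<open>S(y,x) = \<Sum>n. y\<^sup>n w\<^sup>n\<close> with \<open>w\<close> the conjugate of \<open>x\<close>.  The
  coefficient of \<open>S(\<cdot>,x)\<close> at \<open>n\<close> is \<open>w\<^sup>n\<close>, whose conjugate is \<open>x\<^sup>n\<close>, so the inner product with
  \<open>f\<close> is literally the power series of \<open>f\<close> at \<open>x\<close>: this is the reproducing property.

  The closed form comes from a recurrence.  Since \<open>w\<close> is a root of \<open>t\<^sup>2 - 2 Re(x) t + |x|\<^sup>2\<close>, the
  powers \<open>w\<^sup>n\<close> satisfy a second order linear recurrence with real coefficients, and multiplying
  the series on the left by \<open>P(y) = 1 - 2 Re(x) y + |x|\<^sup>2 y\<^sup>2\<close> cancels all but the first terms,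
  leaving \<open>1 - y x\<close> (\<open>szego_denominator_mult_series\<close>).  Non-associativity does no
  harm: left multiplications by elements of one plane \<open>\<real> + \<real> z\<close> compose as in \<open>\<complex>\<close>, for
  \<open>y\<^sup>2\<close> is a real combination of \<open>1\<close> and \<open>y\<close> and the algebra is alternative
  (\<open>slice_left_assoc\<close>).  The identity also shows \<open>P(y) \<noteq> 0\<close>, as \<open>y x = 1\<close> is impossible in the
  ball.  Conjugating the series exchanges \<open>x\<close> and \<open>y\<close>, which turns the first closed form into
  the second.

  Slice monogenicity of \<open>f = S(\<cdot>,x)\<close> is read off from \<open>P(y) f(y) = 1 - y x\<close> by differentiating it in
  the directions \<open>1\<close> and \<open>I\<close>: on a slice, \<open>P\<close> behaves like a holomorphic polynomial, and the two
  equations combine to \<open>P(y) (\<partial>f/\<partial>u + I \<partial>f/\<partial>v) = 0\<close>.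

  For uniqueness, let \<open>K\<close> be any reproducing kernel and \<open>k\<^sub>n\<close> the coefficients of \<open>K(\<cdot>,x)\<close>.
  Testing \<open>K(\<cdot>,x)\<close> against \<open>S(\<cdot>,r)\<close> for real \<open>r\<close> gives
  \<open>\<Sum>n. r\<^sup>n cnj(k\<^sub>n) = S(x,r) = \<Sum>n. r\<^sup>n x\<^sup>n\<close>, and power series in a real variable determine
  their coefficients.
\<close>

section \<open>Octonion algebra\<close>

interpretation octonion_mult: bounded_bilinear "(*) :: octonion \<Rightarrow> octonion \<Rightarrow> octonion"
proof
  show "\<exists>K. \<forall>a b. norm (a * b :: octonion) \<le> norm a * norm b * K"
    by (intro exI [of _ 1]) (simp add: octonion_norm_mult)
qed (simp_all add: octonion_eq_iff times_octonion_def algebra_simps)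

lemmas octonion_bilinear_simps =
  octonion_mult.add_left octonion_mult.add_right octonion_mult.diff_left octonion_mult.diff_right
  octonion_mult.minus_left octonion_mult.minus_right
  octonion_mult.scaleR_left octonion_mult.scaleR_right

lemma bounded_linear_ocnj: "bounded_linear ocnj"
  by (rule bounded_linear_intro [where K = 1])
    (simp_all add: octonion_eq_iff ocnj_def norm_octonion_def)

lemmas ocnj_linear_simps =
  linear_add [OF bounded_linear.linear [OF bounded_linear_ocnj]]
  linear_diff [OF bounded_linear.linear [OF bounded_linear_ocnj]]
  linear_cmul [OF bounded_linear.linear [OF bounded_linear_ocnj]]

lemma ocnj_one [simp]: "ocnj 1 = 1"
  by (simp add: octonion_eq_iff ocnj_def one_octonion_def)

lemma ocnj_ocnj [simp]: "ocnj (ocnj x) = x"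
  by (simp add: octonion_eq_iff ocnj_def)

lemma norm_ocnj [simp]: "norm (ocnj x) = norm x"
  by (simp add: norm_octonion_def ocnj_def)

lemma norm_octonion_one [simp]: "norm (1 :: octonion) = 1"
  by (simp add: norm_octonion_def one_octonion_def)

lemma ocnj_mult: "ocnj (x * y) = ocnj y * ocnj x"
  by (simp add: octonion_eq_iff ocnj_def times_octonion_def algebra_simps)

lemma ocnj_inverse: "ocnj (inverse x) = inverse (ocnj x)"
  by (simp add: octonion_inverse_conv_ocnj ocnj_linear_simps)

lemma ocnj_eq_0_iff [simp]: "ocnj x = 0 \<longleftrightarrow> x = 0"
  by (metis norm_eq_zero norm_ocnj)

lemma octonion_power2: "x\<^sup>2 = x * (x :: octonion)"
  by (simp add: numeral_2_eq_2)

text \<open>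
  This relation keeps \<open>\<real> + \<real> z\<close> closed under multiplication.  Together with alternativity it
  lets such a plane act on the octonions from the left as \<open>\<complex>\<close> would.
\<close>

lemma octonion_quadratic: "x * x = (2 * Ree x) *\<^sub>R x - (norm x)\<^sup>2 *\<^sub>R (1 :: octonion)"
  by (simp add: octonion_eq_iff times_octonion_def one_octonion_def power2_norm_eq_inner
      inner_octonion_def algebra_simps)

lemma imaginary_unit_square: "I \<in> imaginary_units \<Longrightarrow> I * I = - 1"
  by (simp add: octonion_quadratic imaginary_units_def)

lemma slice_generators [simp]: "1 \<in> span {1, z :: octonion}" "z \<in> span {1, z}"
  by (simp_all add: span_base)

lemma slice_mult_closed:
  assumes "a \<in> span {1, z}" and "b \<in> span {1, z :: octonion}"
  shows "a * b \<in> span {1, z}"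
proof -
  obtain p q r s where a: "a = p *\<^sub>R 1 + q *\<^sub>R z" and b: "b = r *\<^sub>R 1 + s *\<^sub>R z"
    using assms by (auto simp: span_breakdown_eq algebra_simps)
  have "a * b = (p * r) *\<^sub>R 1 + (p * s + q * r) *\<^sub>R z + (q * s) *\<^sub>R (z * z)"
    by (simp add: a b octonion_bilinear_simps algebra_simps)
  then show ?thesis
    unfolding octonion_quadratic by (auto intro!: span_add span_diff span_scale)
qed

lemma slice_power_closed: "z ^ n \<in> span {1, z :: octonion}"
  by (induction n) (simp_all add: slice_mult_closed)

lemma slice_commute:
  assumes "a \<in> span {1, z}" and "b \<in> span {1, z :: octonion}"
  shows "a * b = b * a"
proof -
  obtain p q r s where a: "a = p *\<^sub>R 1 + q *\<^sub>R z" and b: "b = r *\<^sub>R 1 + s *\<^sub>R z"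
    using assms by (auto simp: span_breakdown_eq algebra_simps)
  show ?thesis
    by (simp add: a b octonion_bilinear_simps algebra_simps)
qed

text \<open>
  By bilinearity in \<open>a\<close> and \<open>b\<close> the claim reduces to \<open>a = b = z\<close>, which is the left alternative
  law.
\<close>

lemma slice_left_assoc:
  assumes "a \<in> span {1, z}" and "b \<in> span {1, z :: octonion}"
  shows "a * (b * c) = (a * b) * c"
proof -
  obtain p q r s where a: "a = p *\<^sub>R 1 + q *\<^sub>R z" and b: "b = r *\<^sub>R 1 + s *\<^sub>R z"
    using assms by (auto simp: span_breakdown_eq algebra_simps)
  show ?thesis
    by (simp add: a b octonion_bilinear_simps octonion_alternative algebra_simps)
qed

lemma octonion_power_commute: "z ^ n * z = z * (z :: octonion) ^ n"
  by (rule slice_commute [of _ z]) (simp_all add: slice_power_closed)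

lemma octonion_power_Suc_mult: "z * (z ^ n * c) = z ^ Suc n * (c :: octonion)"
  by (simp add: slice_left_assoc [of z z "z ^ n"] slice_power_closed)

lemma norm_octonion_power: "norm (z ^ n) = norm (z :: octonion) ^ n"
  by (induction n) (simp_all add: octonion_norm_mult)

lemma ocnj_power: "ocnj (z ^ n) = ocnj z ^ n"
  by (induction n) (simp_all add: ocnj_mult octonion_power_commute)

lemma octonion_real_power: "(r *\<^sub>R 1) ^ n = r ^ n *\<^sub>R (1 :: octonion)"
  by (induction n) (simp_all add: octonion_bilinear_simps)

text \<open>
  The conjugate of \<open>p\<close> is \<open>2 Re(p) - p\<close>, so the inverse of \<open>p\<close> lies in \<open>\<real> + \<real> p\<close> and
  the product can be reassociated.
\<close>

lemma octonion_inverse_mult_cancel: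
  assumes "p \<noteq> (0 :: octonion)"
  shows "inverse p * (p * c) = c"
proof -
  have "inverse p = (1 / (norm p)\<^sup>2) *\<^sub>R ((2 * Ree p) *\<^sub>R 1 - p)"
    unfolding octonion_inverse_conv_ocnj
    by (simp add: octonion_eq_iff ocnj_def one_octonion_def)
  then have "inverse p \<in> span {1, p}"
    by (auto intro!: span_diff span_scale)
  then show ?thesis
    using assms by (simp add: slice_left_assoc [of _ p] octonion_inverse_mult)
qed

section \<open>The Szego kernel as a power series\<close>

text \<open>
  The point \<open>x\<close> comes first because the denominator is studied as a function of the kernel
  variable \<open>y\<close>.
\<close>

definition szego_denominator :: "octonion \<Rightarrow> octonion \<Rightarrow> octonion" where
  "szego_denominator x y = 1 - (2 * Ree x) *\<^sub>R y + (norm x)\<^sup>2 *\<^sub>R y\<^sup>2"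

lemma szego_kernel_altdef: "szego_kernel y x = inverse (szego_denominator x y) * (1 - y * x)"
  by (simp add: szego_kernel_def szego_denominator_def)

lemma szego_series_summable:
  assumes "x \<in> ball 0 1" and "y \<in> ball 0 1"
  shows "summable (\<lambda>n. y ^ n * ocnj x ^ n)"
proof (rule summable_comparison_test')
  have "norm y * norm x < 1"
    using assms mult_strict_mono [of "norm y" 1 "norm x" 1] by simp
  then show "summable (\<lambda>n. (norm y * norm x) ^ n)"
    by (simp add: summable_geometric)
  show "norm (y ^ n * ocnj x ^ n) \<le> (norm y * norm x) ^ n" for n
    by (simp add: octonion_norm_mult norm_octonion_power power_mult_distrib)
qed

text \<open>
  The powers of \<open>w\<close>, the conjugate of \<open>x\<close>, satisfy
  \<open>w\<^sup>n\<^sup>+\<^sup>2 = 2 Re(x) w\<^sup>n\<^sup>+\<^sup>1 - |x|\<^sup>2 w\<^sup>n\<close>.  After multiplication by \<open>y\<^sup>n\<^sup>+\<^sup>2\<close> on the left this is a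
  relation between the terms of the series and of its products with \<open>y\<close> and \<open>y\<^sup>2\<close>; summing it
  over \<open>n\<close> leaves only the initial terms \<open>1 + y w - 2 Re(x) y = 1 - y x\<close>.
\<close>

lemma szego_denominator_mult_series:
  assumes sums: "(\<lambda>n. y ^ n * ocnj x ^ n) sums S"
  shows "szego_denominator x y * S = 1 - y * x"
proof -
  define w where "w = ocnj x"
  have w_sum: "w + x = (2 * Ree x) *\<^sub>R 1"
    by (simp add: w_def octonion_eq_iff ocnj_def one_octonion_def)
  have w_sq: "w * w = (2 * Ree x) *\<^sub>R w - (norm x)\<^sup>2 *\<^sub>R 1"
    using octonion_quadratic [of w] by (simp add: w_def) (simp add: ocnj_def)
  have S0: "(\<lambda>n. y ^ n * w ^ n) sums S"
    using sums by (simp add: w_def)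
  have S1: "(\<lambda>n. y ^ Suc n * w ^ Suc n) sums (S - 1)"
    using S0 by (subst sums_Suc_iff) simp
  have S2: "(\<lambda>n. y ^ Suc (Suc n) * w ^ Suc (Suc n)) sums (S - 1 - y * w)"
    using S1 by (subst sums_Suc_iff) simp
  note left_mult = bounded_linear.sums [OF octonion_mult.bounded_linear_right]
  have rec: "y ^ Suc (Suc n) * w ^ Suc (Suc n)
      - (2 * Ree x) *\<^sub>R (y * (y ^ Suc n * w ^ Suc n))
      + (norm x)\<^sup>2 *\<^sub>R (y * (y * (y ^ n * w ^ n))) = 0" for n
  proof -
    have "w ^ Suc (Suc n) = (2 * Ree x) *\<^sub>R w ^ Suc n - (norm x)\<^sup>2 *\<^sub>R w ^ n"
      by (simp add: octonion_power_Suc_mult [symmetric] octonion_alternative w_sq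
          octonion_bilinear_simps)
    then show ?thesis
      by (simp only: octonion_power_Suc_mult octonion_bilinear_simps) simp
  qed
  have "(\<lambda>n. 0) sums (S - 1 - y * w - (2 * Ree x) *\<^sub>R (y * (S - 1))
      + (norm x)\<^sup>2 *\<^sub>R (y * (y * S)))"
    using sums_add [OF sums_diff [OF S2 sums_scaleR_right [OF left_mult [OF S1]]]
        sums_scaleR_right [OF left_mult [OF left_mult [OF S0]]],
        of "2 * Ree x" y "(norm x)\<^sup>2" y y]
    by (simp only: rec)
  then have "S - 1 - y * w - (2 * Ree x) *\<^sub>R (y * (S - 1)) + (norm x)\<^sup>2 *\<^sub>R (y * (y * S)) = 0"
    using sums_zero sums_unique2 by metis
  then have "szego_denominator x y * S = 1 + y * w - y * ((2 * Ree x) *\<^sub>R 1)"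
    by (simp add: szego_denominator_def octonion_power2 octonion_bilinear_simps
        octonion_alternative algebra_simps)
  then show ?thesis
    by (simp add: w_sum [symmetric] octonion_bilinear_simps)
qed

lemma szego_denominator_nonzero:
  assumes "x \<in> ball 0 1" and "y \<in> ball 0 1"
  shows "szego_denominator x y \<noteq> 0"
proof
  assume "szego_denominator x y = 0"
  with szego_denominator_mult_series [OF summable_sums [OF szego_series_summable [OF assms]]]
  have "y * x = 1"
    by (simp add: octonion_mult.zero_left)
  then have "norm y * norm x = 1"
    by (metis octonion_norm_mult norm_octonion_one)
  moreover have "norm y * norm x < 1"
    using assms mult_strict_mono [of "norm y" 1 "norm x" 1] by simp
  ultimately show False
    by simp
qed

lemma szego_kernel_sums:
  assumes "x \<in> ball 0 1" and "y \<in> ball 0 1"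
  shows "(\<lambda>n. y ^ n * ocnj x ^ n) sums szego_kernel y x"
proof -
  obtain S where S: "(\<lambda>n. y ^ n * ocnj x ^ n) sums S"
    using szego_series_summable [OF assms] by (auto simp: summable_def)
  have "szego_kernel y x = S"
    using szego_denominator_nonzero [OF assms]
    by (simp add: szego_kernel_altdef szego_denominator_mult_series [OF S, symmetric]
        octonion_inverse_mult_cancel)
  with S show ?thesis
    by simp
qed

text \<open>
  Conjugation reverses products, so it maps the term \<open>y\<^sup>n w\<^sup>n\<close> to \<open>x\<^sup>n v\<^sup>n\<close>, with \<open>w\<close> and \<open>v\<close>
  the conjugates of \<open>x\<close> and \<open>y\<close>.  This Hermitian symmetry transports the left closed form at
  \<open>(x,y)\<close> to the right closed form at \<open>(y,x)\<close>.
\<close>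

lemma ocnj_szego_kernel:
  assumes "x \<in> ball 0 1" and "y \<in> ball 0 1"
  shows "ocnj (szego_kernel y x) = szego_kernel x y"
proof -
  have "(\<lambda>n. ocnj (y ^ n * ocnj x ^ n)) sums ocnj (szego_kernel y x)"
    by (rule bounded_linear.sums [OF bounded_linear_ocnj szego_kernel_sums [OF assms]])
  then show ?thesis
    using szego_kernel_sums [OF assms(2,1)] sums_unique2
    by (auto simp: ocnj_mult ocnj_power)
qed

lemma ocnj_szego_denominator:
  "ocnj (szego_denominator y x) = 1 - (2 * Ree y) *\<^sub>R ocnj x + (norm y)\<^sup>2 *\<^sub>R (ocnj x)\<^sup>2"
  by (simp add: szego_denominator_def ocnj_linear_simps ocnj_power)

lemma szego_kernel_right_form:
  assumes "x \<in> ball 0 1" and "y \<in> ball 0 1"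
  shows "szego_kernel y x = (1 - ocnj y * ocnj x) * inverse (ocnj (szego_denominator y x))"
proof -
  have "szego_kernel y x = ocnj (inverse (szego_denominator y x) * (1 - x * y))"
    using ocnj_szego_kernel [OF assms(2,1)] by (simp add: szego_kernel_altdef)
  then show ?thesis
    by (simp add: ocnj_mult ocnj_inverse ocnj_linear_simps)
qed

section \<open>Membership of the kernel functions in the Hardy space\<close>

lemma szego_denominator_has_derivative:
  "(szego_denominator x has_derivative
     (\<lambda>h. - ((2 * Ree x) *\<^sub>R h) + (norm x)\<^sup>2 *\<^sub>R (y * h + h * y))) (at y)"
  unfolding szego_denominator_def octonion_power2
  by (auto intro!: derivative_eq_intros octonion_mult.FDERIV)

lemma octonion_differentiable_mult:
  fixes f g :: "octonion \<Rightarrow> octonion"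
  assumes "f differentiable (at z within S)" and "g differentiable (at z within S)"
  shows "(\<lambda>z. f z * g z) differentiable (at z within S)"
  using assms unfolding differentiable_def by (blast intro: octonion_mult.FDERIV)

lemma szego_kernel_differentiable:
  assumes "x \<in> ball 0 1" and "y \<in> ball 0 1"
  shows "(\<lambda>y. szego_kernel y x) differentiable (at y)"
proof -
  have den: "szego_denominator x differentiable (at y)"
    using szego_denominator_has_derivative by (auto simp: differentiable_def)
  then have "(\<lambda>z. ocnj (szego_denominator x z)) differentiable (at y)"
    unfolding differentiable_def
    by (blast intro: bounded_linear.has_derivative [OF bounded_linear_ocnj])
  moreover have "(\<lambda>z. 1 / (szego_denominator x z \<bullet> szego_denominator x z)) differentiable (at y)"
    using den szego_denominator_nonzero [OF assms]
    by simp
  moreover have "(\<lambda>z. 1 - z * x) differentiable (at y)"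
    by (intro differentiable_diff octonion_differentiable_mult) simp_all
  ultimately have "(\<lambda>z. ((1 / (szego_denominator x z \<bullet> szego_denominator x z)) *\<^sub>R
      ocnj (szego_denominator x z)) * (1 - z * x)) differentiable (at y)"
    by (intro octonion_differentiable_mult differentiable_scaleR)
  then show ?thesis
    unfolding szego_kernel_altdef octonion_inverse_conv_ocnj power2_norm_eq_inner .
qed

lemma vector_derivative_along_line:
  fixes f :: "'a::real_normed_vector \<Rightarrow> 'b::real_normed_vector"
  assumes f: "(f has_derivative D) (at (a + r *\<^sub>R b))"
  shows "vector_derivative (\<lambda>s. f (a + s *\<^sub>R b)) (at r) = D b"
proof (rule vector_derivative_at)
  have "((\<lambda>s. a + s *\<^sub>R b) has_derivative (\<lambda>h. h *\<^sub>R b)) (at r)"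
    by (auto intro!: derivative_eq_intros)
  from has_derivative_compose [OF this f]
  show "((\<lambda>s. f (a + s *\<^sub>R b)) has_vector_derivative D b) (at r)"
    by (simp add: has_vector_derivative_def linear_cmul [OF has_derivative_linear [OF f]])
qed

text \<open>
  Let \<open>f = S(\<cdot>,x)\<close>, let \<open>P\<close> be its denominator, \<open>y = u + I v\<close> and \<open>E = P'(y)\<close>, where \<open>P\<close> is
  differentiated as a real polynomial.  The product rule applied to \<open>P(y) f(y) = 1 - y x\<close> gives
  \<open>P(y) \<partial>f/\<partial>u = - x - E f(y)\<close> in the direction \<open>1\<close> and
  \<open>P(y) \<partial>f/\<partial>v = - I x - (I E) f(y)\<close> in the direction \<open>I\<close>.  As \<open>I\<close>, \<open>E\<close> and \<open>P(y)\<close> lie in the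
  same slice, multiplying the second equation by \<open>I\<close> from the left gives
  \<open>P(y) (I \<partial>f/\<partial>v) = x + E f(y)\<close>, and the sum with the first one is \<open>0\<close>.
\<close>

lemma slice_monogenic_szego_kernel:
  assumes x: "x \<in> ball 0 1"
  shows "slice_monogenic_on (ball 0 1) (\<lambda>y. szego_kernel y x)"
  unfolding slice_monogenic_on_def
proof (intro conjI ballI allI impI)
  show "(\<lambda>y. szego_kernel y x) differentiable_on ball 0 1"
    using szego_kernel_differentiable [OF x]
    by (auto simp: differentiable_on_def intro: differentiable_at_withinI)
next
  fix I u v
  assume I: "I \<in> imaginary_units" and y_in: "u *\<^sub>R 1 + v *\<^sub>R I \<in> ball 0 (1::real)"
  define y where "y = u *\<^sub>R 1 + v *\<^sub>R I"
  define f where "f = (\<lambda>y. szego_kernel y x)"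
  define P where "P = szego_denominator x"
  define E where "E = - ((2 * Ree x) *\<^sub>R 1) + (2 * (norm x)\<^sup>2) *\<^sub>R y"
  have y: "y \<in> ball 0 1"
    using y_in by (simp add: y_def)
  obtain D where D: "(f has_derivative D) (at y)"
    using szego_kernel_differentiable [OF x y] by (auto simp: differentiable_def f_def)
  have Pf: "P z * f z = 1 - z * x" if "z \<in> ball 0 1" for z
    using szego_denominator_mult_series [OF szego_kernel_sums [OF x that]]
    by (simp add: P_def f_def)
  have y_slice [simp]: "y \<in> span {1, I}"
    unfolding y_def by (intro span_add span_scale) auto
  have E_slice [simp]: "E \<in> span {1, I}"
    unfolding E_def by (intro span_add span_neg span_scale) auto
  have P_slice [simp]: "P y \<in> span {1, I}"
    unfolding P_def szego_denominator_def octonion_power2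
    by (intro span_add span_diff span_scale slice_mult_closed) auto
  have product_rule: "P y * D h + (- ((2 * Ree x) *\<^sub>R h) + (norm x)\<^sup>2 *\<^sub>R (y * h + h * y)) * f y
      = - (h * x)" for h
  proof -
    have lhs: "((\<lambda>z. P z * f z) has_derivative
        (\<lambda>h. P y * D h + (- ((2 * Ree x) *\<^sub>R h) + (norm x)\<^sup>2 *\<^sub>R (y * h + h * y)) * f y)) (at y)"
      unfolding P_def by (rule octonion_mult.FDERIV [OF szego_denominator_has_derivative D])
    have "((\<lambda>z. 1 - z * x) has_derivative (\<lambda>h. 0 - h * x)) (at y)"
      by (intro has_derivative_diff has_derivative_const
          bounded_linear.has_derivative [OF octonion_mult.bounded_linear_left] has_derivative_ident)
    then have rhs: "((\<lambda>z. P z * f z) has_derivative (\<lambda>h. 0 - h * x)) (at y)"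
      by (rule has_derivative_transform_within_open [OF _ open_ball y]) (simp add: Pf)
    show ?thesis
      using fun_cong [OF has_derivative_unique [OF lhs rhs], of h] by simp
  qed
  have du: "P y * D 1 = - x - E * f y"
    using product_rule [of 1]
    by (simp add: E_def algebra_simps scaleR_2 [symmetric] scaleR_left_distrib [symmetric])
  \<comment> \<open>In the direction \<open>I\<close> the factor \<open>I\<close> comes out on the left because it commutes with \<open>y\<close>;
    for directions outside the slice this fails in general.\<close>
  have "- ((2 * Ree x) *\<^sub>R I) + (norm x)\<^sup>2 *\<^sub>R (y * I + I * y) = I * E"
    by (simp add: E_def slice_commute [of y I I] octonion_bilinear_simps scaleR_2 [symmetric])
  then have dv: "P y * D I = - (I * x) - (I * E) * f y"
    using product_rule [of I] by (simp add: algebra_simps)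
  \<comment> \<open>Both sides are the product of \<open>D I\<close> with \<open>P y\<close> times \<open>I\<close>, which commute within the slice.\<close>
  have "P y * (I * D I) = I * (P y * D I)"
    by (simp add: slice_left_assoc [of _ I] slice_commute [of "P y" I I])
  also have "\<dots> = - ((I * I) * x) - (I * I) * (E * f y)"
    by (simp add: dv octonion_bilinear_simps octonion_alternative
        slice_left_assoc [of I I E, symmetric])
  also have "\<dots> = x + E * f y"
    by (simp add: imaginary_unit_square [OF I] octonion_bilinear_simps)
  finally have "P y * (D 1 + I * D I) = 0"
    by (simp add: octonion_mult.add_right du)
  moreover have "P y \<noteq> 0"
    using szego_denominator_nonzero [OF x y] by (simp add: P_def)
  ultimately have CR: "D 1 + I * D I = 0"
    by (metis norm_eq_zero octonion_norm_mult mult_eq_0_iff)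
  have "vector_derivative (\<lambda>s. f (s *\<^sub>R 1 + v *\<^sub>R I)) (at u) = D 1"
    using vector_derivative_along_line [of f D "v *\<^sub>R I" u 1] D by (simp add: y_def add.commute)
  moreover have "vector_derivative (\<lambda>t. f (u *\<^sub>R 1 + t *\<^sub>R I)) (at v) = D I"
    using vector_derivative_along_line [of f D "u *\<^sub>R 1" v I] D by (simp add: y_def)
  ultimately show "(1/2) *\<^sub>R (vector_derivative (\<lambda>s. szego_kernel (s *\<^sub>R 1 + v *\<^sub>R I) x) (at u)
      + I * vector_derivative (\<lambda>t. szego_kernel (u *\<^sub>R 1 + t *\<^sub>R I) x) (at v)) = 0"
    using CR by (simp add: f_def)
qed

lemma has_expansion_szego_kernel:
  "x \<in> ball 0 1 \<Longrightarrow> has_expansion (\<lambda>y. szego_kernel y x) (\<lambda>n. ocnj x ^ n)"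
  by (simp add: has_expansion_def szego_kernel_sums)

lemma szego_kernel_in_hardy2:
  assumes "x \<in> ball 0 1"
  shows "(\<lambda>y. szego_kernel y x) \<in> hardy2"
proof -
  have "(norm x)\<^sup>2 < 1"
    using assms by (simp add: power_less_one_iff)
  moreover have "(norm (ocnj x ^ n))\<^sup>2 = ((norm x)\<^sup>2) ^ n" for n
    by (simp add: norm_octonion_power mult.commute flip: power_mult)
  ultimately have "summable (\<lambda>n. (norm (ocnj x ^ n))\<^sup>2)"
    by (simp add: summable_geometric)
  then show ?thesis
    using slice_monogenic_szego_kernel [OF assms] has_expansion_szego_kernel [OF assms]
    by (auto simp: hardy2_def)
qed

section \<open>Coefficients and the reproducing property\<close>

text \<open>
  The constant coefficient is the limit of the sum at \<open>0\<close>; once it vanishes, the series can be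
  divided by \<open>r\<close>.  Excluding \<open>r = 0\<close> from the hypothesis is what makes this division
  preserve it.
\<close>

lemma power_series_zero_imp_coeffs_zero:
  fixes c :: "nat \<Rightarrow> real"
  assumes "\<And>r. r \<noteq> 0 \<Longrightarrow> \<bar>r\<bar> < 1 \<Longrightarrow> (\<lambda>n. c n * r ^ n) sums 0"
  shows "c n = 0"
  using assms
proof (induction n arbitrary: c)
  case 0
  have "((\<lambda>_. 0) \<longlongrightarrow> c 0) (at (0 :: real))"
    by (rule powser_limit_0_strong [of 1]) (simp_all add: "0.prems")
  then show ?case
    by (simp add: tendsto_const_iff)
next
  case (Suc n)
  have "((\<lambda>_. 0) \<longlongrightarrow> c 0) (at (0 :: real))"
    by (rule powser_limit_0_strong [of 1]) (simp_all add: Suc.prems)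
  then have c0: "c 0 = 0"
    by (simp add: tendsto_const_iff)
  have "(\<lambda>n. c (Suc n) * r ^ n) sums 0" if r: "r \<noteq> 0" "\<bar>r\<bar> < 1" for r
  proof -
    have "(\<lambda>n. c (Suc n) * r ^ Suc n) sums 0"
      using Suc.prems [OF r] by (subst sums_Suc_iff) (simp add: c0)
    from sums_mult [OF this, of "1 / r"] show ?thesis
      using r by simp
  qed
  then show ?case
    by (rule Suc.IH)
qed

text \<open>
  Restricting to real arguments removes the non-commutativity: each real coordinate of the
  difference is an ordinary real power series with sum zero.
\<close>

lemma octonion_real_series_unique:
  fixes a b :: "nat \<Rightarrow> octonion"
  assumes a: "\<And>r. \<bar>r\<bar> < 1 \<Longrightarrow> (\<lambda>n. r ^ n *\<^sub>R a n) sums F r"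
    and b: "\<And>r. \<bar>r\<bar> < 1 \<Longrightarrow> (\<lambda>n. r ^ n *\<^sub>R b n) sums F r"
  shows "a = b"
proof
  fix n
  have "(a n - b n) \<bullet> i = 0" for i
  proof (rule power_series_zero_imp_coeffs_zero [of "\<lambda>n. (a n - b n) \<bullet> i"])
    fix r :: real
    assume "\<bar>r\<bar> < 1"
    from bounded_linear.sums [OF bounded_linear_inner_left sums_diff [OF a b], OF this this]
    show "(\<lambda>n. (a n - b n) \<bullet> i * r ^ n) sums 0"
      by (simp flip: scaleR_diff_right add: mult.commute)
  qed
  then show "a n = b n"
    by (metis inner_eq_zero_iff right_minus_eq)
qed

lemma has_expansion_at_real:
  assumes "has_expansion f a" and "\<bar>r\<bar> < 1"
  shows "(\<lambda>n. r ^ n *\<^sub>R a n) sums f (r *\<^sub>R 1)"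
proof -
  have "r *\<^sub>R 1 \<in> ball (0 :: octonion) 1"
    using assms(2) by simp
  then have "(\<lambda>n. (r *\<^sub>R 1) ^ n * a n) sums f (r *\<^sub>R 1)"
    using assms(1) unfolding has_expansion_def by blast
  then show ?thesis
    by (simp add: octonion_real_power octonion_bilinear_simps)
qed

lemma expansion_coeffs_eq:
  assumes "has_expansion f a"
  shows "expansion_coeffs f = a"
  unfolding expansion_coeffs_def
proof (rule the_equality)
  show "b = a" if "has_expansion f b" for b
    using octonion_real_series_unique [OF has_expansion_at_real [OF that] has_expansion_at_real [OF assms]] .
qed (rule assms)

lemma hardy_inner_szego_kernel:
  assumes "f \<in> hardy2" and x: "x \<in> ball 0 1"
  shows "hardy_inner f (\<lambda>y. szego_kernel y x) = f x"
proof -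
  obtain a where a: "has_expansion f a"
    using assms(1) by (auto simp: hardy2_def)
  then have "(\<lambda>n. x ^ n * a n) sums f x"
    using x by (simp add: has_expansion_def)
  then show ?thesis
    by (simp add: hardy_inner_def expansion_coeffs_eq [OF a] ocnj_power
        expansion_coeffs_eq [OF has_expansion_szego_kernel [OF x]] sums_iff)
qed

text \<open>
  The kernel functions \<open>S(\<cdot>,r)\<close> at real points \<open>r\<close> have the real coefficients \<open>r\<^sup>n\<close> and
  serve as test functions.  The reproducing property of \<open>K\<close> evaluates their inner
  product with \<open>K(\<cdot>,x)\<close> to \<open>S(x,r)\<close>, a power series in \<open>r\<close> that can be compared with the
  definition of the inner product.
\<close>

lemma reproducing_kernel_unique:
  assumes K: "reproducing_kernel K" and x: "x \<in> ball 0 1" and y: "y \<in> ball 0 1"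
  shows "K y x = szego_kernel y x"
proof -
  have "(\<lambda>y. K y x) \<in> hardy2"
    using K x by (simp add: reproducing_kernel_def)
  then obtain k where k: "has_expansion (\<lambda>y. K y x) k"
    by (auto simp: hardy2_def)
  have "(\<lambda>n. ocnj (k n)) = (\<lambda>n. x ^ n)"
  proof (rule octonion_real_series_unique)
    fix r :: real
    assume r: "\<bar>r\<bar> < 1"
    then have r_in: "r *\<^sub>R 1 \<in> ball (0 :: octonion) 1"
      by simp
    have ocnj_r: "ocnj (r *\<^sub>R 1) ^ n = r ^ n *\<^sub>R 1" for n
      by (simp add: ocnj_linear_simps octonion_real_power)
    show "(\<lambda>n. r ^ n *\<^sub>R x ^ n) sums szego_kernel x (r *\<^sub>R 1)"
      using szego_kernel_sums [OF r_in x] by (simp add: ocnj_r octonion_bilinear_simps)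
    \<comment> \<open>The inner product is an infinite sum whose value is only meaningful once convergence is
      known; here it follows from the expansion of \<open>K(\<cdot>,x)\<close> at \<open>r\<close>.\<close>
    have "(\<lambda>n. ocnj (r ^ n *\<^sub>R k n)) sums ocnj (K (r *\<^sub>R 1) x)"
      by (rule bounded_linear.sums [OF bounded_linear_ocnj has_expansion_at_real [OF k r]])
    then have conj_sums: "(\<lambda>n. r ^ n *\<^sub>R ocnj (k n)) sums ocnj (K (r *\<^sub>R 1) x)"
      by (simp add: ocnj_linear_simps)
    have "szego_kernel x (r *\<^sub>R 1) = hardy_inner (\<lambda>y. szego_kernel y (r *\<^sub>R 1)) (\<lambda>y. K y x)"
      using K x szego_kernel_in_hardy2 [OF r_in] by (simp add: reproducing_kernel_def)
    also have "\<dots> = (\<Sum>n. r ^ n *\<^sub>R ocnj (k n))"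
      by (simp add: hardy_inner_def expansion_coeffs_eq [OF k] ocnj_r octonion_bilinear_simps
          expansion_coeffs_eq [OF has_expansion_szego_kernel [OF r_in]])
    finally show "(\<lambda>n. r ^ n *\<^sub>R ocnj (k n)) sums szego_kernel x (r *\<^sub>R 1)"
      using conj_sums by (simp add: sums_iff)
  qed
  then have "k = (\<lambda>n. ocnj x ^ n)"
    by (metis ocnj_ocnj ocnj_power)
  then have "(\<lambda>n. y ^ n * ocnj x ^ n) sums K y x"
    using k y by (simp add: has_expansion_def)
  then show ?thesis
    using szego_kernel_sums [OF x y] by (rule sums_unique2)
qed

theorem theorem4p6:
  shows "reproducing_kernel szego_kernel \<and>
    (\<forall>K. reproducing_kernel K \<longrightarrow>
       (\<forall>x\<in>ball 0 1. \<forall>y\<in>ball 0 1. K y x = szego_kernel y x)) \<and>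
    (\<forall>x\<in>ball 0 1. \<forall>y\<in>ball 0 1.
       1 - (2 * Ree x) *\<^sub>R y + (norm x)\<^sup>2 *\<^sub>R y\<^sup>2 \<noteq> 0 \<and>
       1 - (2 * Ree y) *\<^sub>R ocnj x + (norm y)\<^sup>2 *\<^sub>R (ocnj x)\<^sup>2 \<noteq> 0 \<and>
       szego_kernel y x =
         inverse (1 - (2 * Ree x) *\<^sub>R y + (norm x)\<^sup>2 *\<^sub>R y\<^sup>2) * (1 - y * x) \<and>
       szego_kernel y x =
         (1 - ocnj y * ocnj x) *
           inverse (1 - (2 * Ree y) *\<^sub>R ocnj x + (norm y)\<^sup>2 *\<^sub>R (ocnj x)\<^sup>2)) \<and>
    (\<forall>f\<in>hardy2. \<forall>x\<in>ball 0 1. hardy_inner f (\<lambda>y. szego_kernel y x) = f x)"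
proof (intro conjI allI ballI impI)
  show "reproducing_kernel szego_kernel"
    by (simp add: reproducing_kernel_def szego_kernel_in_hardy2 hardy_inner_szego_kernel)
next
  fix K and x y :: octonion
  assume "reproducing_kernel K" "x \<in> ball 0 1" "y \<in> ball 0 1"
  then show "K y x = szego_kernel y x"
    by (rule reproducing_kernel_unique)
next
  fix x y :: octonion
  assume xy: "x \<in> ball 0 1" "y \<in> ball 0 1"
  show "1 - (2 * Ree x) *\<^sub>R y + (norm x)\<^sup>2 *\<^sub>R y\<^sup>2 \<noteq> 0"
    using szego_denominator_nonzero [OF xy] by (simp add: szego_denominator_def)
  show "1 - (2 * Ree y) *\<^sub>R ocnj x + (norm y)\<^sup>2 *\<^sub>R (ocnj x)\<^sup>2 \<noteq> 0"
    using szego_denominator_nonzero [OF xy(2,1)] by (simp flip: ocnj_szego_denominator)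
  show "szego_kernel y x =
      inverse (1 - (2 * Ree x) *\<^sub>R y + (norm x)\<^sup>2 *\<^sub>R y\<^sup>2) * (1 - y * x)"
    by (rule szego_kernel_def)
  show "szego_kernel y x = (1 - ocnj y * ocnj x) *
      inverse (1 - (2 * Ree y) *\<^sub>R ocnj x + (norm y)\<^sup>2 *\<^sub>R (ocnj x)\<^sup>2)"
    using szego_kernel_right_form [OF xy] by (simp only: ocnj_szego_denominator)
next
  fix f :: "octonion \<Rightarrow> octonion" and x :: octonion
  assume "f \<in> hardy2" "x \<in> ball 0 1"
  then show "hardy_inner f (\<lambda>y. szego_kernel y x) = f x"
    by (rule hardy_inner_szego_kernel)
qed

end
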